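(* Let $k\ge 0$ be an integer and let $(a_n)_{n\ge0}$ be the $k$-shifted Catalan sequence, i.e. $a_n=0$ for $n<k$ and $a_n=C_{n-k}=\frac{1}{n-k+1}\binom{2(n-k)}{n-k}$ for $n\ge k$. Let $(b_n)_{n\ge0}$ be its Catalan transform, $b_n=\sum_{j=0}^{n}\frac{j}{2n-j}\binom{2n-j}{n-j}a_j$ (the coefficient being $1$ when $n=j=0$). Then $b_n=0$ for $n\le k-1$, $b_k=1$, and for $n\ge k+1$, $b_n$ equals the number of integer sequences $(u_1,\ldots,u_{n-k})$ satisfying $1\le u_i\le n$ for all $i$ and such that for all $1\le i<j\le n-k$, $u_j-(j-i)\notin[1,u_i-1]$.
   Context: $[a,b]$ denotes the set of integers $m$ with $a\le m\le b$ (empty if $b<a$). *)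

theory Defs
  imports Complex_Main "HOL-Library.FuncSet"
begin

definition catalan_number :: "nat \<Rightarrow> rat" where
  "catalan_number n = 1 / (of_nat n + 1) * of_nat ((2 * n) choose n)"

definition shifted_catalan :: "nat \<Rightarrow> nat \<Rightarrow> rat" where
  "shifted_catalan k n = (if n < k then 0 else catalan_number (n - k))"

(* Only used for j \<le> n, where the truncated subtractions are exact.
   The entry for n = j = 0 is set to 1 separately, since 0 / 0 = 0 in HOL. *)
definition catalan_transform_coeff :: "nat \<Rightarrow> nat \<Rightarrow> rat" where
  "catalan_transform_coeff n j =
     (if n = 0 \<and> j = 0 then 1
      else of_nat j / of_nat (2 * n - j) * of_nat ((2 * n - j) choose (n - j)))"

definition catalan_transform :: "(nat \<Rightarrow> rat) \<Rightarrow> nat \<Rightarrow> rat" where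
  "catalan_transform a n = (\<Sum>j = 0..n. catalan_transform_coeff n j * a j)"

(* A sequence of length m is an extensional function on the index set {1..m}
   (undefined elsewhere), so that each sequence is counted exactly once. *)
definition admissible_seqs :: "nat \<Rightarrow> nat \<Rightarrow> (nat \<Rightarrow> int) set" where
  "admissible_seqs n m =
     {u \<in> {1..m} \<rightarrow>\<^sub>E {1..int n}.
        \<forall>i j. 1 \<le> i \<and> i < j \<and> j \<le> m \<longrightarrow>
          u j - (int j - int i) \<notin> {1..u i - 1}}"

end

theory Submission imports Defs begin

text \<open>
  Put \<open>v i = i - u (i + 1)\<close> for \<open>0 \<le> i < m\<close>, where \<open>m = n - k\<close>. The condition on \<open>u\<close> becomes
  \<open>j - n \<le> v j < j\<close> together with the noncrossing condition that \<open>v j < i < j\<close> implies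
  \<open>v j \<le> v i\<close>. Build \<open>v\<close> from left to right: the number of completions of a prefix depends
  only on the number \<open>q\<close> of negative and the number \<open>r\<close> of nonnegative values that may come
  next. Solving the resulting linear recurrence with the kernel method suggests an explicit
  solution in terms of the ballot numbers \<open>[x^e] C(x)^r\<close>, where \<open>C\<close> is the Catalan
  generating function; it is verified by induction. At \<open>q = m + k\<close>, \<open>r = 0\<close>
  it is the coefficient of \<open>x^m\<close> in \<open>C(x)^k C(x C(x))\<close>, which is the Catalan transform at \<open>m + k\<close>.
\<close>

section \<open>Ballot numbers and Catalan coefficients\<close>

text \<open>The coefficient of \<open>x^e\<close> in \<open>C(x)^r\<close>; the recursion expresses \<open>C^(r+1) = C^r + x C^(r+2)\<close>.\<close>

fun ballot :: "nat \<Rightarrow> nat \<Rightarrow> nat" where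
  "ballot 0 r = 1"
| "ballot (Suc e) 0 = 0"
| "ballot (Suc e) (Suc r) = ballot (Suc e) r + ballot e (Suc (Suc r))"

text \<open>Pascal's rule matches the recursion of \<open>ballot\<close>; at \<open>r = 0\<close>
  the two middle binomials of an odd row agree. The additive form avoids truncated
  subtraction.\<close>

lemma ballot_add_binomial:
  "ballot (Suc e) r + (2 * e + 1 + r choose e) = (2 * e + 1 + r choose Suc e)"
proof (induction e arbitrary: r)
  case 0
  show ?case by (induction r) auto
next
  case (Suc e)
  note IH = Suc.IH
  show ?case
  proof (induction r)
    case 0
    have "(2 * Suc e + 1 choose Suc e) = (2 * Suc e + 1 choose Suc (Suc e))"
      by (subst binomial_symmetric) auto
    then show ?case by simp
  next
    case (Suc r)
    let ?N = "2 * Suc e + 1 + r"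
    have "ballot (Suc e) (r + 2) + (?N choose e) = (?N choose Suc e)"
      using IH[of "r + 2"] by (simp add: numeral_2_eq_2)
    with Suc.IH show ?case by (simp add: numeral_2_eq_2)
  qed
qed

lemma ballot_closed_form:
  assumes "0 < e + r"
  shows "(of_nat (ballot e r) :: rat) =
           of_nat r / of_nat (2 * e + r) * of_nat (2 * e + r choose e)"
proof (cases e)
  case 0
  then show ?thesis using assms by simp
next
  case (Suc d)
  let ?N = "2 * d + 1 + r"
  define X Y :: rat where "X = of_nat (?N choose d)" and "Y = of_nat (?N choose Suc d)"
  have "Suc d * (?N choose Suc d) = (?N - d) * (?N choose d)"
    by (metis binomial_absorb_comp binomial_absorption mult.commute diff_Suc_1 add_Suc_right
        add.commute plus_1_eq_Suc)
  then have "Suc d * (?N choose Suc d) = (Suc d + r) * (?N choose d)"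
    by simp
  from arg_cong[OF this, of "of_nat :: nat \<Rightarrow> rat"]
  have absorb: "(of_nat d + 1) * Y = (of_nat d + 1 + of_nat r) * X"
    unfolding X_def Y_def by (simp add: algebra_simps)
  have ballot: "of_nat (ballot e r) = Y - X"
    using arg_cong[OF ballot_add_binomial[of d r], of "of_nat :: nat \<Rightarrow> rat"]
    unfolding X_def Y_def Suc by (simp add: algebra_simps)
  have binomial: "of_nat (2 * e + r choose e) = X + Y"
    unfolding X_def Y_def Suc by simp
  \<comment> \<open>The factor \<open>d + 1\<close> makes \<open>absorb\<close> applicable and is
    cancelled afterwards.\<close>
  have "(of_nat d + 1) * ((Y - X) * (2 * of_nat d + 2 + of_nat r))
      = (of_nat d + 1) * (of_nat r * (X + Y))"
    using absorb by algebra
  then have "(Y - X) * (2 * of_nat d + 2 + of_nat r) = of_nat r * (X + Y)"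
    by (metis mult_cancel_left of_nat_Suc of_nat_neq_0 add.commute)
  moreover have "of_nat (2 * e + r) = (2 * of_nat d + 2 + of_nat r :: rat)"
    unfolding Suc by simp
  moreover have "of_nat (2 * e + r) \<noteq> (0 :: rat)"
    using Suc by simp
  ultimately show ?thesis
    unfolding ballot binomial by (simp add: field_simps)
qed

lemma catalan_number_eq_ballot: "catalan_number n = of_nat (ballot n 1)"
proof -
  have "Suc n * (2 * n + 1 choose n) = (2 * n + 1) * (2 * n choose n)"
    using binomial_absorb_comp[of "2 * n + 1" n] by simp
  from arg_cong[OF this, of "of_nat :: nat \<Rightarrow> rat"]
  have "(of_nat n + 1) * of_nat (2 * n + 1 choose n) =
      (2 * of_nat n + 1) * (of_nat (2 * n choose n) :: rat)"
    by (simp add: algebra_simps)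
  moreover have nz: "of_nat n + 1 \<noteq> (0 :: rat)" "2 * of_nat n + 1 \<noteq> (0 :: rat)"
    by (simp_all add: add_nonneg_eq_0_iff)
  moreover have "(2 * of_nat n + 1) * of_nat (ballot n 1) = (of_nat (2 * n + 1 choose n) :: rat)"
    using ballot_closed_form[of n 1] nz by (simp add: field_simps)
  ultimately have "(2 * of_nat n + 1) * of_nat (2 * n choose n)
      = (2 * of_nat n + 1) * ((of_nat n + 1) * (of_nat (ballot n 1) :: rat))"
    by algebra
  then have "of_nat (2 * n choose n) = (of_nat n + 1) * (of_nat (ballot n 1) :: rat)"
    using nz(2) by (simp only: mult_cancel_left) simp
  then show ?thesis
    unfolding catalan_number_def using nz(1) by simp
qed

text \<open>The coefficient is that of \<open>x^n\<close> in \<open>(x C(x))^j\<close>, so the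
  transform substitutes \<open>x C(x)\<close> into a generating function.\<close>

lemma catalan_transform_coeff_eq_ballot:
  assumes "j \<le> n"
  shows "catalan_transform_coeff n j = of_nat (ballot (n - j) j)"
proof (cases "n = 0")
  case True
  then show ?thesis using assms by (simp add: catalan_transform_coeff_def)
next
  case False
  have "2 * (n - j) + j = 2 * n - j" using assms by simp
  then show ?thesis
    using ballot_closed_form[of "n - j" j] assms False
    by (simp add: catalan_transform_coeff_def)
qed

text \<open>This is \<open>C^r C^s = C^(r+s)\<close>, proved by expanding the first factor with
  \<open>C^(r+1) = C^r + x C^(r+2)\<close>.\<close>

lemma ballot_convolution:
  "(\<Sum>e\<le>m. ballot e r * ballot (m - e) s) = ballot m (r + s)"
proof (induction m arbitrary: r)
  case 0
  show ?case by simp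
next
  case (Suc m)
  note IH = Suc.IH
  show ?case
  proof (induction r)
    case 0
    show ?case by (simp add: sum.atMost_Suc_shift del: sum.atMost_Suc)
  next
    case (Suc r)
    have "(\<Sum>e\<le>Suc m. ballot e (Suc r) * ballot (Suc m - e) s)
        = (\<Sum>e\<le>Suc m. ballot e r * ballot (Suc m - e) s)
          + (\<Sum>e\<le>m. ballot e (r + 2) * ballot (m - e) s)"
      unfolding sum.atMost_Suc_shift by (simp add: algebra_simps sum.distrib)
    also have "\<dots> = ballot (Suc m) (Suc r + s)"
      using Suc.IH IH[of "r + 2"] by simp
    finally show ?case .
  qed
qed

lemma sum_ballot: "(\<Sum>l<L. ballot e (2 + l)) = ballot (Suc e) L"
  by (induction L) auto

section \<open>The completion recurrence and its solution\<close>

text \<open>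
  The number of ways to append \<open>m\<close> further values in state \<open>(q, r)\<close>. Each step makes the current
  position available, discards all values above the chosen one, and raises the lower bound by one,
  which removes a negative value if there is one.
\<close>

fun completions :: "nat \<Rightarrow> nat \<Rightarrow> nat \<Rightarrow> nat" where
  "completions 0 q r = 1"
| "completions (Suc m) q r = (\<Sum>p<r. completions m (q - 1) (p + 2)) + (\<Sum>p<q. completions m p 1)"

definition completions_formula :: "nat \<Rightarrow> nat \<Rightarrow> nat \<Rightarrow> nat" where
  "completions_formula m q r =
     ballot m r + (\<Sum>e<m. ballot (m - 1 - e) 1 * (\<Sum>l<q - e. ballot e (r + 1 + l)))"

text \<open>The sum recurrence is checked through its differences, here in \<open>r\<close>. The
  ballot recursion splits every term with \<open>e > 0\<close>; shifting \<open>e\<close> turns the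
  bound \<open>q - e\<close> into \<open>q - 1 - e\<close>.\<close>

lemma completions_formula_Suc_right:
  "completions_formula (Suc m) q (Suc r) =
     completions_formula (Suc m) q r + completions_formula m (q - 1) (r + 2)"
proof -
  have "(\<Sum>e<Suc m. ballot (m - e) 1 * (\<Sum>l<q - e. ballot e (Suc r + 1 + l)))
      = (\<Sum>e<Suc m. ballot (m - e) 1 * (\<Sum>l<q - e. ballot e (r + 1 + l)))
        + (\<Sum>e<m. ballot (m - 1 - e) 1 * (\<Sum>l<q - 1 - e. ballot e (r + 2 + 1 + l)))"
    unfolding sum.lessThan_Suc_shift
    by (simp add: algebra_simps sum.distrib)
  then show ?thesis
    unfolding completions_formula_def by simp
qed

lemma completions_formula_Suc_middle:
  "completions_formula (Suc m) (Suc q) 0 =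
     completions_formula (Suc m) q 0 + completions_formula m q 1"
proof -
  have step: "(\<Sum>l<Suc q - e. ballot e (1 + l))
      = (\<Sum>l<q - e. ballot e (1 + l)) + (if e \<le> q then ballot e (1 + q - e) else 0)" for e
    by (auto simp: Suc_diff_le)
  \<comment> \<open>The \<open>if\<close> disappears after the shift: for \<open>Suc e > q\<close>
    the truncated \<open>q - e\<close> is 0, and \<open>ballot (Suc e) 0 = 0\<close>.\<close>
  have "(\<Sum>e<Suc m. ballot (m - e) 1 * (if e \<le> q then ballot e (1 + q - e) else 0))
      = ballot m 1 + (\<Sum>e<m. ballot (m - 1 - e) 1 * ballot (Suc e) (q - e))"
    unfolding sum.lessThan_Suc_shift by (auto intro!: sum.cong)
  then show ?thesis
    unfolding completions_formula_def diff_Suc_1 add_0 step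
    by (simp add: algebra_simps sum.distrib flip: sum_ballot)
qed

lemma completions_formula_Suc_sum:
  "completions_formula (Suc m) q r =
     (\<Sum>p<r. completions_formula m (q - 1) (p + 2)) + (\<Sum>p<q. completions_formula m p 1)"
proof (induction r)
  case 0
  show ?case
  proof (induction q)
    case 0
    show ?case by (simp add: completions_formula_def)
  next
    case (Suc q)
    then show ?case by (simp add: completions_formula_Suc_middle)
  qed
next
  case (Suc r)
  then show ?case by (simp add: completions_formula_Suc_right)
qed

lemma completions_eq_formula: "completions m q r = completions_formula m q r"
proof (induction m arbitrary: q r)
  case 0
  show ?case by (simp add: completions_formula_def)
next
  case (Suc m)
  then show ?case by (simp add: completions_formula_Suc_sum)
qed

text \<open>Splitting off \<open>l = 0\<close> from each inner sum leaves a convolution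
  \<open>C * C\<close>, which supplies the term \<open>t = Suc m\<close>; the rest, read backwards,
  gives the terms \<open>t \<le> m\<close>.\<close>

lemma completions_start:
  "completions (Suc m) (Suc m + k) 0 = (\<Sum>t\<le>Suc m. ballot t 1 * ballot (Suc m - t) (k + t))"
proof -
  have inner: "(\<Sum>l<Suc L. ballot e (1 + l)) = ballot e 1 + ballot (Suc e) L" for e L
    using sum_ballot[of e L] by (simp add: sum.lessThan_Suc_shift del: sum.lessThan_Suc)
  have "completions (Suc m) (Suc m + k) 0
      = (\<Sum>e\<le>m. ballot (m - e) 1 * (\<Sum>l<Suc (m - e + k). ballot e (1 + l)))"
    unfolding completions_eq_formula completions_formula_def lessThan_Suc_atMost[symmetric] diff_Suc_1
    by (auto intro!: sum.cong simp: Suc_diff_le simp del: sum.lessThan_Suc)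
  also have "\<dots> = (\<Sum>e\<le>m. ballot e 1 * ballot (m - e) 1)
      + (\<Sum>e\<le>m. ballot (m - e) 1 * ballot (Suc e) (m - e + k))"
    unfolding inner by (simp add: algebra_simps sum.distrib)
  also have "(\<Sum>e\<le>m. ballot e 1 * ballot (m - e) 1) = ballot (Suc m) 1"
    unfolding ballot_convolution by simp
  also have "(\<Sum>e\<le>m. ballot (m - e) 1 * ballot (Suc e) (m - e + k))
      = (\<Sum>t\<le>m. ballot t 1 * ballot (Suc m - t) (k + t))"
    by (rule sum.reindex_bij_witness[where i = "\<lambda>t. m - t" and j = "\<lambda>e. m - e"])
       (auto simp: Suc_diff_le add.commute)
  finally show ?thesis by simp
qed

section \<open>Counting noncrossing lists from left to right\<close>

lemma sum_rank:
  fixes X :: "'a :: linorder set"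
  assumes "finite X"
  shows "(\<Sum>x\<in>X. g (card {y \<in> X. y < x})) = (\<Sum>p<card X. g p :: nat)"
  using assms
proof (induction X rule: finite_linorder_max_induct)
  case empty
  show ?case by simp
next
  case (insert b A)
  have "{y \<in> insert b A. y < x} = {y \<in> A. y < x}" if "x \<in> A" for x
    using insert.hyps that by auto
  moreover have "{y \<in> insert b A. y < b} = A"
    using insert.hyps by auto
  moreover have "b \<notin> A" using insert.hyps by auto
  ultimately show ?case using insert by simp
qed

definition choices :: "nat \<Rightarrow> int list \<Rightarrow> int set" where
  "choices n v = {s. int (length v) - int n \<le> s \<and> s < int (length v) \<and>
     (\<forall>i<length v. s < int i \<longrightarrow> s \<le> v ! i)}"

definition extensions :: "nat \<Rightarrow> int list \<Rightarrow> nat \<Rightarrow> int list set" where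
  "extensions n v m = {ws. length ws = m \<and> (\<forall>j<m. ws ! j \<in> choices n (v @ take j ws))}"

lemma finite_choices [simp]: "finite (choices n v)"
  by (rule finite_subset[of _ "{int (length v) - int n..int (length v)}"]) (auto simp: choices_def)

text \<open>No earlier index exceeds the new value \<open>length v\<close>, so it is always allowed;
  an old value survives if it is at most \<open>s\<close> and meets the raised lower bound.\<close>

lemma choices_snoc:
  assumes "s \<in> choices n v" "0 < n"
  shows "choices n (v @ [s]) =
    insert (int (length v)) {t \<in> choices n v. t \<le> s \<and> int (length v) - int n < t}"
  using assms unfolding choices_def
  by (auto simp: nth_append less_Suc_eq)

lemma extensions_0 [simp]: "extensions n v 0 = {[]}"
  by (auto simp: extensions_def)

lemma extensions_Suc:
  "extensions n v (Suc m) = (\<Union>s\<in>choices n v. (#) s ` extensions n (v @ [s]) m)"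
proof -
  have "s # ws \<in> extensions n v (Suc m) \<longleftrightarrow> s \<in> choices n v \<and> ws \<in> extensions n (v @ [s]) m"
    for s ws
    by (auto simp: extensions_def All_less_Suc2)
  moreover have "[] \<notin> extensions n v (Suc m)"
    by (simp add: extensions_def)
  ultimately show ?thesis
    by (auto simp: image_iff) (metis list.exhaust)
qed

lemma finite_extensions [simp]: "finite (extensions n v m)"
  by (induction m arbitrary: v) (auto simp: extensions_Suc)

lemma card_extensions_Suc:
  "card (extensions n v (Suc m)) = (\<Sum>s\<in>choices n v. card (extensions n (v @ [s]) m))"
  unfolding extensions_Suc
  by (subst card_UN_disjoint) (auto simp: card_image)

text \<open>A negative value lies below every index, so the noncrossing condition bounds it only
  from above.\<close>

lemma choices_neg:
  assumes "t \<in> choices n v" "t < 0" "int (length v) - int n \<le> s" "s \<le> t"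
  shows "s \<in> choices n v"
  using assms unfolding choices_def by force

lemma card_extensions:
  assumes "length v + m \<le> n"
  shows "card (extensions n v m) =
    completions m (card {s \<in> choices n v. s < 0}) (card {s \<in> choices n v. 0 \<le> s})"
  using assms
proof (induction m arbitrary: v)
  case 0
  show ?case by simp
next
  case (Suc m)
  have len: "length v < n" and IH: "card (extensions n (v @ [s]) m) =
      completions m (card {t \<in> choices n (v @ [s]). t < 0}) (card {t \<in> choices n (v @ [s]). 0 \<le> t})" for s
    using Suc by simp_all
  let ?Neg = "\<lambda>v. {s \<in> choices n v. s < 0}" and ?Nonneg = "\<lambda>v. {s \<in> choices n v. 0 \<le> s}"
  let ?b = "int (length v) - int n"
  have nonneg: "card (?Neg (v @ [s])) = card (?Neg v) - 1 \<and>
      card (?Nonneg (v @ [s])) = card {t \<in> ?Nonneg v. t < s} + 2"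
    if s: "s \<in> ?Nonneg v" for s
  proof
    have Neg: "?Neg (v @ [s]) = ?Neg v - {?b}"
      using s len by (subst choices_snoc) (auto simp: choices_def)
    \<comment> \<open>Exactly one negative value is lost, unless there is none; then truncation
      gives \<open>0 - 1 = 0\<close>.\<close>
    have "?b \<in> ?Neg v" if nonempty: "?Neg v \<noteq> {}"
    proof -
      obtain t where "t \<in> choices n v" "t < 0" using nonempty by auto
      moreover from this have "?b \<le> t" by (simp add: choices_def)
      ultimately show ?thesis using choices_neg[of t n v ?b] by simp
    qed
    then show "card (?Neg (v @ [s])) = card (?Neg v) - 1"
      unfolding Neg by (cases "?Neg v = {}")
        (simp_all only: card_Diff_singleton empty_Diff card.empty diff_0_eq_0 simp_thms)
    have "?Nonneg (v @ [s]) = insert (int (length v)) (insert s {t \<in> ?Nonneg v. t < s})"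
      using s len by (subst choices_snoc) (auto simp: choices_def)
    moreover have "s < int (length v)" using s by (auto simp: choices_def)
    ultimately show "card (?Nonneg (v @ [s])) = card {t \<in> ?Nonneg v. t < s} + 2"
      by simp
  qed
  have neg: "card (?Neg (v @ [s])) = card {t \<in> ?Neg v. t < s} \<and> card (?Nonneg (v @ [s])) = 1"
    if s: "s \<in> ?Neg v" for s
  proof
    have "?Nonneg (v @ [s]) = {int (length v)}"
      using s len by (subst choices_snoc) auto
    then show "card (?Nonneg (v @ [s])) = 1" by simp
    \<comment> \<open>Losing \<open>?b\<close> is balanced by keeping \<open>s\<close>
      itself.\<close>
    have "{t \<in> ?Neg v. t < s} = {?b..<s}"
      using s choices_neg[of s n v] by (auto simp: choices_def)
    moreover have "?Neg (v @ [s]) = {?b<..s}"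
      using s len choices_neg[of s n v] by (subst choices_snoc) (auto simp: choices_def)
    ultimately show "card (?Neg (v @ [s])) = card {t \<in> ?Neg v. t < s}"
      by simp
  qed
  have "choices n v = ?Nonneg v \<union> ?Neg v" by auto
  then have "card (extensions n v (Suc m)) =
      (\<Sum>s\<in>?Nonneg v. card (extensions n (v @ [s]) m)) + (\<Sum>s\<in>?Neg v. card (extensions n (v @ [s]) m))"
    unfolding card_extensions_Suc by (subst sum.union_disjoint[symmetric]) auto
  also have "(\<Sum>s\<in>?Nonneg v. card (extensions n (v @ [s]) m)) =
      (\<Sum>s\<in>?Nonneg v. completions m (card (?Neg v) - 1) (card {t \<in> ?Nonneg v. t < s} + 2))"
    using nonneg by (intro sum.cong refl) (simp only: IH)
  also have "\<dots> = (\<Sum>p<card (?Nonneg v). completions m (card (?Neg v) - 1) (p + 2))"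
    by (rule sum_rank) simp
  also have "(\<Sum>s\<in>?Neg v. card (extensions n (v @ [s]) m)) =
      (\<Sum>s\<in>?Neg v. completions m (card {t \<in> ?Neg v. t < s}) 1)"
    using neg by (intro sum.cong refl) (simp only: IH)
  also have "\<dots> = (\<Sum>p<card (?Neg v). completions m p 1)"
    by (rule sum_rank) simp
  finally show ?case by simp
qed

section \<open>Translation to admissible sequences\<close>

definition seq_list :: "nat \<Rightarrow> (nat \<Rightarrow> int) \<Rightarrow> int list" where
  "seq_list m u = map (\<lambda>i. int i - u (Suc i)) [0..<m]"

lemma length_seq_list [simp]: "length (seq_list m u) = m"
  and nth_seq_list [simp]: "i < m \<Longrightarrow> seq_list m u ! i = int i - u (Suc i)"
  by (simp_all add: seq_list_def)

lemma seq_list_in_extensions_iff: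
  assumes "u \<in> extensional {1..m}"
  shows "seq_list m u \<in> extensions n [] m \<longleftrightarrow> u \<in> admissible_seqs n m"
proof -
  have range: "u \<in> {1..m} \<rightarrow>\<^sub>E {1..int n} \<longleftrightarrow> (\<forall>j<m. u (Suc j) \<in> {1..int n})"
    unfolding PiE_iff image_Suc_lessThan[symmetric] ball_simps(9) using assms
    by (simp add: image_Suc_lessThan Ball_def)
  have pairs: "(\<forall>i j. 1 \<le> i \<and> i < j \<and> j \<le> m \<longrightarrow> P i j) \<longleftrightarrow> (\<forall>j<m. \<forall>i<j. P (Suc i) (Suc j))"
    (is "?L \<longleftrightarrow> ?R") for P
  proof
    assume ?R
    show ?L
    proof (intro allI impI)
      fix i j assume "1 \<le> i \<and> i < j \<and> j \<le> m"
      then show "P i j"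
        using \<open>?R\<close>[rule_format, of "j - 1" "i - 1"] by force
    qed
  qed simp
  \<comment> \<open>With \<open>v = seq_list m u\<close>, membership in the forbidden interval reads
    \<open>v ! i < v ! j\<close> and \<open>v ! j < i\<close>.\<close>
  have crossing: "u (Suc j) - (int (Suc j) - int (Suc i)) \<notin> {1..u (Suc i) - 1} \<longleftrightarrow>
      (int j - u (Suc j) < int i \<longrightarrow> int j - u (Suc j) \<le> int i - u (Suc i))" for i j
    by auto
  have "seq_list m u ! j \<in> choices n ([] @ take j (seq_list m u)) \<longleftrightarrow>
      u (Suc j) \<in> {1..int n} \<and>
      (\<forall>i<j. u (Suc j) - (int (Suc j) - int (Suc i)) \<notin> {1..u (Suc i) - 1})" if "j < m" for j
    unfolding crossing using that by (auto simp: choices_def)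
  then have "seq_list m u \<in> extensions n [] m \<longleftrightarrow> (\<forall>j<m. u (Suc j) \<in> {1..int n}) \<and>
      (\<forall>j<m. \<forall>i<j. u (Suc j) - (int (Suc j) - int (Suc i)) \<notin> {1..u (Suc i) - 1})"
    unfolding extensions_def mem_Collect_eq length_seq_list by blast
  also have "\<dots> \<longleftrightarrow> u \<in> admissible_seqs n m"
    unfolding admissible_seqs_def mem_Collect_eq range pairs ..
  finally show ?thesis .
qed

lemma card_admissible_seqs: "card (admissible_seqs n m) = card (extensions n [] m)"
proof (rule bij_betw_same_card)
  show "bij_betw (seq_list m) (admissible_seqs n m) (extensions n [] m)"
  proof (rule bij_betwI')
    fix u u' assume "u \<in> admissible_seqs n m" "u' \<in> admissible_seqs n m"
    then have "u \<in> extensional {1..m}" "u' \<in> extensional {1..m}"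
      by (auto simp: admissible_seqs_def PiE_def)
    moreover have "u i = u' i" if "seq_list m u = seq_list m u'" "i \<in> {1..m}" for i
      using that nth_seq_list[of "i - 1" m u] nth_seq_list[of "i - 1" m u'] by force
    ultimately show "seq_list m u = seq_list m u' \<longleftrightarrow> u = u'"
      by (auto intro: extensionalityI)
  next
    fix u assume u: "u \<in> admissible_seqs n m"
    then show "seq_list m u \<in> extensions n [] m"
      by (subst seq_list_in_extensions_iff) (auto simp: admissible_seqs_def PiE_def)
  next
    fix ws assume ws: "ws \<in> extensions n [] m"
    define u where "u = restrict (\<lambda>i. int (i - 1) - ws ! (i - 1)) {1..m}"
    have "ws = seq_list m u"
      using ws by (intro nth_equalityI) (auto simp: u_def extensions_def)
    moreover have "u \<in> extensional {1..m}" by (simp add: u_def)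
    ultimately show "\<exists>u\<in>admissible_seqs n m. ws = seq_list m u"
      using ws seq_list_in_extensions_iff by blast
  qed
qed

lemma card_extensions_Nil:
  assumes "m \<le> n"
  shows "card (extensions n [] m) = completions m n 0"
proof -
  have "{s \<in> choices n []. s < 0} = {- int n..<0}"
    by (auto simp: choices_def)
  moreover have "{s \<in> choices n []. 0 \<le> s} = {}"
    by (auto simp: choices_def)
  ultimately have "card {s \<in> choices n []. s < 0} = n" "card {s \<in> choices n []. 0 \<le> s} = 0"
    by (simp_all only: card.empty card_atLeastLessThan_int)
  then show ?thesis using card_extensions[of "[]" m n] assms
    by (simp only: list.size add_0)
qed

section \<open>Evaluation of the Catalan transform\<close>

lemma catalan_transform_shifted_catalan:
  "catalan_transform (shifted_catalan k) (m + k) =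
     of_nat (\<Sum>t\<le>m. ballot t 1 * ballot (m - t) (k + t))"
proof -
  have "catalan_transform (shifted_catalan k) (m + k) =
      (\<Sum>j\<in>{k..m + k}. of_nat (ballot (m + k - j) j * ballot (j - k) 1))"
    unfolding catalan_transform_def
    by (rule sum.mono_neutral_cong_right)
       (auto simp: shifted_catalan_def catalan_transform_coeff_eq_ballot catalan_number_eq_ballot)
  also have "\<dots> = (\<Sum>t\<le>m. of_nat (ballot t 1 * ballot (m - t) (k + t)))"
    \<comment> \<open>Setting \<open>t = j - k\<close> produces the sum of
      \<open>completions_start\<close>.\<close>
    by (rule sum.reindex_bij_witness[where i = "\<lambda>t. t + k" and j = "\<lambda>j. j - k"])
       (auto simp: mult.commute)
  finally show ?thesis by simp
qed

theorem theorem7: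
  fixes k :: nat
    and a b :: "nat \<Rightarrow> rat"
  assumes a_def: "a = shifted_catalan k"
    and b_def: "b = catalan_transform a"
  shows "(\<forall>n. n < k \<longrightarrow> b n = 0) \<and>
         b k = 1 \<and>
         (\<forall>n. n \<ge> k + 1 \<longrightarrow> b n = of_nat (card (admissible_seqs n (n - k))))"
proof (intro conjI allI impI)
  fix n assume "n < k"
  then show "b n = 0"
    by (simp add: b_def a_def catalan_transform_def shifted_catalan_def)
next
  show "b k = 1"
    using catalan_transform_shifted_catalan[of k 0] by (simp add: b_def a_def)
next
  fix n assume "n \<ge> k + 1"
  then obtain m where n: "n = Suc m + k"
    by (metis add.commute add_Suc_right le_Suc_ex Suc_eq_plus1)
  have "card (admissible_seqs n (Suc m)) = completions (Suc m) (Suc m + k) 0"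
    by (simp add: card_admissible_seqs card_extensions_Nil n del: completions.simps)
  then show "b n = of_nat (card (admissible_seqs n (n - k)))"
    unfolding a_def b_def n
    by (simp only: catalan_transform_shifted_catalan completions_start add_diff_cancel_right')
qed

end
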